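(* Let $G$ be an abelian group (written multiplicatively), and let $(G,Par)$ denote the set of all quadruples $(a,b,c,d)\in G^4$ for which $Par(a,b,c,d)$ holds, with the componentwise operation $(a_1,b_1,c_1,d_1)\,@\,(a_2,b_2,c_2,d_2)=(a_1a_2,b_1b_2,c_1c_2,d_1d_2)$. Then $(G,Par)$ under $@$ is an abelian group.
   Context: For $a,b,c,d\in G$, we say that $a,b,c,d$ form a parallelogram, written $Par(a,b,c,d)$, if there are $p,q\in G$ such that $pa=qb$ and $pd=qc$. The assertion includes that the set of parallelogram quadruples is closed under $@$. *)

theory Defs
  imports "HOL-Algebra.Group"
begin

definition Par :: "('a, 'm) monoid_scheme \<Rightarrow> 'a \<Rightarrow> 'a \<Rightarrow> 'a \<Rightarrow> 'a \<Rightarrow> bool" where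
  "Par G a b c d \<longleftrightarrow>
     (\<exists>p \<in> carrier G. \<exists>q \<in> carrier G.
        p \<otimes>\<^bsub>G\<^esub> a = q \<otimes>\<^bsub>G\<^esub> b \<and> p \<otimes>\<^bsub>G\<^esub> d = q \<otimes>\<^bsub>G\<^esub> c)"

definition par_op ::
  "('a, 'm) monoid_scheme \<Rightarrow> 'a \<times> 'a \<times> 'a \<times> 'a \<Rightarrow> 'a \<times> 'a \<times> 'a \<times> 'a \<Rightarrow> 'a \<times> 'a \<times> 'a \<times> 'a" where
  "par_op G = (\<lambda>(a1, b1, c1, d1) (a2, b2, c2, d2).
     (a1 \<otimes>\<^bsub>G\<^esub> a2, b1 \<otimes>\<^bsub>G\<^esub> b2, c1 \<otimes>\<^bsub>G\<^esub> c2, d1 \<otimes>\<^bsub>G\<^esub> d2))"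

(* Closure of the carrier under par_op is not built into this record; it is part of
   what comm_group asserts about it.  The record type requires a unit to be named;
   since the operation is componentwise, it is the quadruple of units. *)
definition par_group :: "('a, 'm) monoid_scheme \<Rightarrow> ('a \<times> 'a \<times> 'a \<times> 'a) monoid" where
  "par_group G =
     \<lparr> carrier = {(a, b, c, d). a \<in> carrier G \<and> b \<in> carrier G \<and> c \<in> carrier G \<and> d \<in> carrier G
                    \<and> Par G a b c d},
       mult = par_op G,
       one = (\<one>\<^bsub>G\<^esub>, \<one>\<^bsub>G\<^esub>, \<one>\<^bsub>G\<^esub>, \<one>\<^bsub>G\<^esub>) \<rparr>"

end

theory Submission
  imports Defs
begin

text \<open>The parallelogram quadruples form a subgroup of the direct power \<open>G\<close>^4. The
  equations \<open>p \<otimes> a = q \<otimes> b\<close> and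
  \<open>p \<otimes> d = q \<otimes> c\<close> can be multiplied together and inverted, because
  \<open>G\<close> is commutative, so witnesses multiply and invert along with the quadruples.
  \<open>Par_one\<close>, \<open>Par_mult\<close> and \<open>Par_inv\<close> give the subgroup
  conditions; the remaining laws hold componentwise.\<close>

lemma par_group_simps [simp]:
  "(a, b, c, d) \<in> carrier (par_group G) \<longleftrightarrow>
     a \<in> carrier G \<and> b \<in> carrier G \<and> c \<in> carrier G \<and> d \<in> carrier G \<and> Par G a b c d"
  "(a, b, c, d) \<otimes>\<^bsub>par_group G\<^esub> (a', b', c', d') =
     (a \<otimes>\<^bsub>G\<^esub> a', b \<otimes>\<^bsub>G\<^esub> b', c \<otimes>\<^bsub>G\<^esub> c', d \<otimes>\<^bsub>G\<^esub> d')"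
  "\<one>\<^bsub>par_group G\<^esub> = (\<one>\<^bsub>G\<^esub>, \<one>\<^bsub>G\<^esub>, \<one>\<^bsub>G\<^esub>, \<one>\<^bsub>G\<^esub>)"
  by (simp_all add: par_group_def par_op_def)

lemma (in monoid) Par_one: "Par G \<one> \<one> \<one> \<one>"
  unfolding Par_def by blast

text \<open>Closure: if \<open>p\<close>, \<open>q\<close> and \<open>p'\<close>, \<open>q'\<close>
  witness the factors, then \<open>p \<otimes> p'\<close> and \<open>q \<otimes> q'\<close> witness
  the product.\<close>

lemma (in comm_monoid) Par_mult:
  assumes "Par G a b c d" "Par G a' b' c' d'"
    and carr: "a \<in> carrier G" "b \<in> carrier G" "c \<in> carrier G" "d \<in> carrier G"
      "a' \<in> carrier G" "b' \<in> carrier G" "c' \<in> carrier G" "d' \<in> carrier G"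
  shows "Par G (a \<otimes> a') (b \<otimes> b') (c \<otimes> c') (d \<otimes> d')"
proof -
  obtain p q where pq: "p \<in> carrier G" "q \<in> carrier G" "p \<otimes> a = q \<otimes> b" "p \<otimes> d = q \<otimes> c"
    using assms(1) unfolding Par_def by blast
  obtain p' q' where pq': "p' \<in> carrier G" "q' \<in> carrier G"
      "p' \<otimes> a' = q' \<otimes> b'" "p' \<otimes> d' = q' \<otimes> c'"
    using assms(2) unfolding Par_def by blast
  \<comment> \<open>Interchange law: it brings each witness next to its own entry, so that the given
    equations apply factor by factor.\<close>
  have swap: "(x \<otimes> x') \<otimes> (y \<otimes> y') = (x \<otimes> y) \<otimes> (x' \<otimes> y')"
    if "x \<in> carrier G" "x' \<in> carrier G" "y \<in> carrier G" "y' \<in> carrier G" for x x' y y'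
    using that by (simp add: m_ac)
  have "(p \<otimes> p') \<otimes> (a \<otimes> a') = (q \<otimes> q') \<otimes> (b \<otimes> b')"
    "(p \<otimes> p') \<otimes> (d \<otimes> d') = (q \<otimes> q') \<otimes> (c \<otimes> c')"
    using pq pq' carr by (simp_all add: swap)
  then show ?thesis
    unfolding Par_def using pq pq' by blast
qed

text \<open>Inverting both sides of the two equations shows that \<open>inv p\<close> and
  \<open>inv q\<close> are witnesses.\<close>

lemma (in comm_group) Par_inv:
  assumes "Par G a b c d"
    and carr: "a \<in> carrier G" "b \<in> carrier G" "c \<in> carrier G" "d \<in> carrier G"
  shows "Par G (inv a) (inv b) (inv c) (inv d)"
proof -
  obtain p q where pq: "p \<in> carrier G" "q \<in> carrier G" "p \<otimes> a = q \<otimes> b" "p \<otimes> d = q \<otimes> c"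
    using assms(1) unfolding Par_def by blast
  have "inv p \<otimes> inv a = inv q \<otimes> inv b" "inv p \<otimes> inv d = inv q \<otimes> inv c"
    using pq carr by (simp_all flip: inv_mult)
  then show ?thesis
    unfolding Par_def using pq by blast
qed

theorem corollary3:
  fixes G :: "('a, 'm) monoid_scheme"
  assumes "comm_group G"
  shows "comm_group (par_group G)"
proof -
  interpret comm_group G by (fact assms)
  show ?thesis
  proof (rule comm_groupI)
    fix x assume "x \<in> carrier (par_group G)"
    then obtain a b c d where x: "x = (a, b, c, d)"
      and mem: "a \<in> carrier G" "b \<in> carrier G" "c \<in> carrier G" "d \<in> carrier G" "Par G a b c d"
      by (cases x) simp
    show "\<exists>y\<in>carrier (par_group G). y \<otimes>\<^bsub>par_group G\<^esub> x = \<one>\<^bsub>par_group G\<^esub>"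
      by (rule bexI [where x = "(inv\<^bsub>G\<^esub> a, inv\<^bsub>G\<^esub> b, inv\<^bsub>G\<^esub> c, inv\<^bsub>G\<^esub> d)"]) 
          (use x mem in \<open>simp_all add: Par_inv\<close>)
  \<comment> \<open>Closure and membership of the unit come from \<open>Par_mult\<close> and
    \<open>Par_one\<close>; associativity, commutativity and the unit law are inherited from
    \<open>G\<close> in each component.\<close>
  qed (auto simp: Par_one Par_mult m_ac)
qed

end
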